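(* Let $k>0$ be an integer. For each rational number $q$ with $0 \leq q \leq 2k-1$, there exists a weighted $k$-majority tournament $T$ and a dominating set $D$ of $T$ such that $W(T,D) = q$.
   Context: Let $k \ge 1$ be an integer and let $V$ be a finite nonempty set. Linear orders on $V$ are strict total orders. A $k$-majority tournament $T$ with vertex set $V(T)=V$ is defined by a list of $2k-1$ (not necessarily distinct) linear orders on $V$: for distinct $u,v\in V$ there is a directed edge $u\to v$ in $T$ if and only if $u>v$ in at least $k$ of the $2k-1$ orders. A weighted $k$-majority tournament is a $k$-majority tournament (with its defining orders) in which each edge $u\to v$ carries the weight $w(u\to v)$ equal to the number of the $2k-1$ orders in which $u>v$ (so $k\le w(u\to v)\le 2k-1$). A dominating set of $T$ is a set $D\subseteq V(T)$ such that for every $v\in V(T)\setminus D$ there is $u\in D$ with $u\to v$. (In particular $D\neq\emptyset$, since $V\ne\emptyset$.) For a dominating set $D$ and a vertex $v$, the average inweight of $v$ with respect to $D$ is $$w_a(v,D)=\frac{1}{|D|}\sum_{u\in D,\ u\to v} w(u\to v),$$ and the weight (approval gap) of $D$ on $T$ is $W(T,D)=\min_{v\in V(T)\setminus D} w_a(v,D)$ if $D\neq V(T)$, and $W(T,D)=0$ if $D=V(T)$. *)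

theory Defs
  imports Complex_Main
begin

(* A linear order is given by its "greater than" relation: (u, v) in r means that u > v in r.
   The orders form a list, since an order may be used more than once. *)
record 'a ordered_voting =
  verts :: "'a set"
  orders :: "('a \<times> 'a) set list"

definition weighted_majority_tournament :: "nat \<Rightarrow> 'a ordered_voting \<Rightarrow> bool" where
  "weighted_majority_tournament k T \<longleftrightarrow>
     finite (verts T) \<and> verts T \<noteq> {} \<and>
     length (orders T) = 2 * k - 1 \<and>
     (\<forall>r \<in> set (orders T). r \<subseteq> verts T \<times> verts T \<and> strict_linear_order_on (verts T) r)"

definition edge_weight :: "'a ordered_voting \<Rightarrow> 'a \<Rightarrow> 'a \<Rightarrow> nat" where
  "edge_weight T u v = length (filter (\<lambda>r. (u, v) \<in> r) (orders T))"

definition edge :: "nat \<Rightarrow> 'a ordered_voting \<Rightarrow> 'a \<Rightarrow> 'a \<Rightarrow> bool" where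
  "edge k T u v \<longleftrightarrow>
     u \<in> verts T \<and> v \<in> verts T \<and> u \<noteq> v \<and> k \<le> edge_weight T u v"

definition dominating_set :: "nat \<Rightarrow> 'a ordered_voting \<Rightarrow> 'a set \<Rightarrow> bool" where
  "dominating_set k T D \<longleftrightarrow>
     D \<subseteq> verts T \<and> (\<forall>v \<in> verts T - D. \<exists>u \<in> D. edge k T u v)"

definition average_inweight :: "nat \<Rightarrow> 'a ordered_voting \<Rightarrow> 'a set \<Rightarrow> 'a \<Rightarrow> rat" where
  "average_inweight k T D v =
     (\<Sum>u \<in> {u \<in> D. edge k T u v}. of_nat (edge_weight T u v)) / of_nat (card D)"

definition approval_gap :: "nat \<Rightarrow> 'a ordered_voting \<Rightarrow> 'a set \<Rightarrow> rat" where
  "approval_gap k T D =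
     (if D = verts T then 0 else Min (average_inweight k T D ` (verts T - D)))"

end

theory Submission
  imports Defs
begin

text \<open>
  Unanimous voters already realise every rational value in the range. If all \<open>2 * k - 1\<close> orders agree, every
  edge has the maximal weight \<open>2 * k - 1\<close>. Let \<open>D\<close> consist of all vertices except one vertex \<open>a\<close>
  that has exactly \<open>a\<close> vertices above it, among \<open>n + 1\<close> vertices in total. Then \<open>a\<close> is the only
  vertex outside \<open>D\<close>, and its average inweight is \<open>(2 * k - 1) * a / n\<close>. It remains to write
  \<open>q / (2 * k - 1)\<close>, a rational number between 0 and 1, as \<open>a / n\<close>. The set \<open>D\<close> dominates as soon
  as \<open>a > 0\<close>, that is, \<open>q > 0\<close>; for \<open>q = 0\<close> the whole vertex set serves as \<open>D\<close>.
\<close>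

text \<open>
  A smaller number is ranked higher, so that a vertex \<open>v\<close> has exactly \<open>v\<close> vertices above it.
\<close>

definition unanimous_voting :: "nat \<Rightarrow> nat \<Rightarrow> nat ordered_voting" where
  "unanimous_voting k n =
     \<lparr>verts = {..n}, orders = replicate (2 * k - 1) {(u, v). u < v \<and> v \<le> n}\<rparr>"

lemma verts_unanimous_voting [simp]: "verts (unanimous_voting k n) = {..n}"
  by (simp add: unanimous_voting_def)

lemma weighted_majority_tournament_unanimous_voting:
  "weighted_majority_tournament k (unanimous_voting k n)"
  by (auto simp: weighted_majority_tournament_def unanimous_voting_def
      strict_linear_order_on_def trans_def irrefl_def total_on_def)

lemma edge_weight_unanimous_voting:
  "edge_weight (unanimous_voting k n) u v = (if u < v \<and> v \<le> n then 2 * k - 1 else 0)"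
  by (simp add: edge_weight_def unanimous_voting_def)

lemma edge_unanimous_voting:
  assumes "k > 0"
  shows "edge k (unanimous_voting k n) u v \<longleftrightarrow> u < v \<and> v \<le> n"
  using assms by (auto simp: edge_def edge_weight_unanimous_voting)

lemma dominating_set_all_but_one:
  assumes "k > 0" and "0 < a"
  shows "dominating_set k (unanimous_voting k n) ({..n} - {a})"
  using assms by (auto simp: dominating_set_def edge_unanimous_voting intro!: bexI[of _ 0])

lemma approval_gap_all_but_one:
  assumes "k > 0" and "a \<le> n"
  shows "approval_gap k (unanimous_voting k n) ({..n} - {a}) =
           (2 * of_nat k - 1) * (of_nat a / of_nat n)"
proof -
  have outside: "{..n} - ({..n} - {a}) = {a}" and not_all: "{..n} - {a} \<noteq> {..n}"
    using assms by auto
  have in_neighbours: "{u \<in> {..n} - {a}. edge k (unanimous_voting k n) u a} = {..<a}"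
    using assms by (auto simp: edge_unanimous_voting)
  have weights: "(\<Sum>u<a. of_nat (edge_weight (unanimous_voting k n) u a)) =
      (2 * of_nat k - 1) * (of_nat a :: rat)"
    using assms by (simp add: edge_weight_unanimous_voting of_nat_diff)
  have "card ({..n} - {a}) = n"
    using assms by simp
  then have "average_inweight k (unanimous_voting k n) ({..n} - {a}) a =
      (2 * of_nat k - 1) * (of_nat a / of_nat n)"
    unfolding average_inweight_def in_neighbours weights by simp
  then show ?thesis
    unfolding approval_gap_def verts_unanimous_voting outside using not_all by simp
qed

lemma rat_unit_interval_as_nat_quotient:
  fixes p :: rat
  assumes "0 < p" and "p \<le> 1"
  obtains a n :: nat where "0 < a" and "a \<le> n" and "p = of_nat a / of_nat n"
proof -
  obtain i j :: int where p: "p = of_int i / of_int j" and "j > 0"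
    by (metis quotient_of_div quotient_of_denom_pos surj_pair)
  with assms have "i > 0" and "i \<le> j"
    by (auto simp: zero_less_divide_iff divide_le_eq)
  then show thesis
    using p \<open>j > 0\<close> by (intro that[of "nat i" "nat j"]) auto
qed

theorem proposition1:
  fixes k :: nat and q :: rat
  assumes "k > 0"
    and "0 \<le> q" and "q \<le> 2 * of_nat k - 1"
  shows "\<exists>(T :: nat ordered_voting) D.
           weighted_majority_tournament k T \<and> dominating_set k T D \<and> approval_gap k T D = q"
proof (cases "q = 0")
  case True
  have "dominating_set k (unanimous_voting k 0) {..0}"
    and "approval_gap k (unanimous_voting k 0) {..0} = q"
    using True by (simp_all add: dominating_set_def approval_gap_def)
  then show ?thesis
    using weighted_majority_tournament_unanimous_voting by blast
next
  case False
  have pos: "(0 :: rat) < 2 * of_nat k - 1"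
    using False assms by linarith
  then have "0 < q / (2 * of_nat k - 1)" and "q / (2 * of_nat k - 1) \<le> 1"
    using False assms by auto
  then obtain a n :: nat where an: "0 < a" "a \<le> n"
      and quotient: "q / (2 * of_nat k - 1) = of_nat a / of_nat n"
    by (rule rat_unit_interval_as_nat_quotient)
  have "approval_gap k (unanimous_voting k n) ({..n} - {a}) = q"
    using pos by (simp add: approval_gap_all_but_one assms(1) an(2) flip: quotient)
  then show ?thesis
    using weighted_majority_tournament_unanimous_voting
      dominating_set_all_but_one[OF assms(1) an(1)] by blast
qed

end
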